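(* Let $S$ be a reduced information semialgebra and let $n\ge 2$ be an integer. If $U_n(S)$ satisfies the ACCP, then $U_n(S)$ is atomic.
   Context: All monoids are cancellative but not necessarily commutative. An information semialgebra is a semiring $S$ with $0$ and $1$ (so $(S,+)$ is a commutative monoid with identity $0$, multiplication has identity $1$ and distributes over addition, and $0\cdot x=0$ for all $x$) such that $(S,+)$ is a cancellative commutative monoid whose only invertible element is $0$, and $(S\setminus\{0\},\cdot)$ is a cancellative commutative monoid. $S$ is reduced if $1$ is the only invertible element of $(S\setminus\{0\},\cdot)$. $U_n(S)$ is the multiplicative monoid of $n\times n$ upper triangular matrices over $S$ all of whose diagonal entries equal $1$. A monoid $M$ satisfies the ACCP if every ascending chain of principal left ideals $Mx$ stabilizes and every ascending chain of principal right ideals $xM$ stabilizes. An atom of $M$ is a non-invertible $a$ such that $a=uv$ implies that $u$ or $v$ is invertible; $M$ is atomic if each non-invertible element is a finite product of atoms. *)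

theory Defs
  imports "HOL-Algebra.Coset" "Jordan_Normal_Form.Matrix"
begin

text \<open>
  The carrier of the semialgebra is the whole type. The axiom \<open>1 \<noteq> 0\<close> and the absence of zero
  divisors say that the nonzero elements form a monoid under multiplication.
  Library classes for cancellative \<^emph>\<open>commutative\<close> addition come with a subtraction operation,
  which an information semialgebra does not have; hence \<^class>\<open>cancel_semigroup_add\<close>
  (cancellation only) on top of \<^class>\<open>comm_semiring_1\<close>.
\<close>

class information_semialgebra =
  comm_semiring_1 + semiring_no_zero_divisors_cancel + cancel_semigroup_add +
  assumes add_eq_zero_imp_zero: "a + b = 0 \<Longrightarrow> a = 0"

class reduced_information_semialgebra = information_semialgebra +
  assumes mult_eq_one_imp_one: "a * b = 1 \<Longrightarrow> a = 1"

definition unitriangular :: "nat \<Rightarrow> 'a :: semiring_1 mat monoid" where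
  "unitriangular n =
    \<lparr>carrier = {A \<in> carrier_mat n n. upper_triangular A \<and> (\<forall>i<n. A $$ (i, i) = 1)},
     monoid.mult = (*), one = 1\<^sub>m n\<rparr>"

text \<open>
  The principal left ideal \<open>Mx\<close> is \<open>carrier M #>\<^bsub>M\<^esub> x\<close> and the principal right
  ideal \<open>xM\<close> is \<open>x <#\<^bsub>M\<^esub> carrier M\<close>; the coset operations are defined for arbitrary
  magmas.
\<close>

definition satisfies_ACCP :: "('a, 'b) monoid_scheme \<Rightarrow> bool" where
  "satisfies_ACCP M \<longleftrightarrow>
    (\<forall>x :: nat \<Rightarrow> 'a. (\<forall>k. x k \<in> carrier M) \<longrightarrow>
       (\<forall>k. carrier M #>\<^bsub>M\<^esub> x k \<subseteq> carrier M #>\<^bsub>M\<^esub> x (Suc k)) \<longrightarrow>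
       (\<exists>N. \<forall>k\<ge>N. carrier M #>\<^bsub>M\<^esub> x k = carrier M #>\<^bsub>M\<^esub> x N)) \<and>
    (\<forall>x :: nat \<Rightarrow> 'a. (\<forall>k. x k \<in> carrier M) \<longrightarrow>
       (\<forall>k. x k <#\<^bsub>M\<^esub> carrier M \<subseteq> x (Suc k) <#\<^bsub>M\<^esub> carrier M) \<longrightarrow>
       (\<exists>N. \<forall>k\<ge>N. x k <#\<^bsub>M\<^esub> carrier M = x N <#\<^bsub>M\<^esub> carrier M))"

text \<open>
  The library's \<open>irreducible\<close> is stated through divisibility from one side, so in a
  noncommutative monoid it is not by definition the notion of an atom.
\<close>

definition monoid_atom :: "('a, 'b) monoid_scheme \<Rightarrow> 'a \<Rightarrow> bool" where
  "monoid_atom M a \<longleftrightarrow> a \<in> carrier M \<and> a \<notin> Units M \<and>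
    (\<forall>u\<in>carrier M. \<forall>v\<in>carrier M. a = u \<otimes>\<^bsub>M\<^esub> v \<longrightarrow> u \<in> Units M \<or> v \<in> Units M)"

definition atomic_monoid :: "('a, 'b) monoid_scheme \<Rightarrow> bool" where
  "atomic_monoid M \<longleftrightarrow>
    (\<forall>x\<in>carrier M. x \<notin> Units M \<longrightarrow>
       (\<exists>as. (\<forall>a\<in>set as. monoid_atom M a) \<and> x = foldr (\<otimes>\<^bsub>M\<^esub>) as \<one>\<^bsub>M\<^esub>))"

end

theory Submission imports Defs begin

text \<open>
  Unitriangular matrices over an additively cancellative semiring form a cancellative monoid:
  the diagonal entries \<open>1\<close> allow the entries of a factor to be recovered one after the other.
  In a cancellative monoid, passing to a proper left or right factor strictly enlarges the
  principal right or left ideal, so by the ACCP both kinds of proper factor are well-founded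
  relations. Induction along left factors yields an atom dividing any given non-unit from the
  left, and splitting off such atoms terminates by induction along right factors.
\<close>

section \<open>Factorization in cancellative monoids\<close>

locale cancellative_monoid = monoid M for M (structure) +
  assumes mult_left_cancel:
      "\<lbrakk>a \<in> carrier M; x \<in> carrier M; y \<in> carrier M; a \<otimes> x = a \<otimes> y\<rbrakk> \<Longrightarrow> x = y"
    and mult_right_cancel:
      "\<lbrakk>a \<in> carrier M; x \<in> carrier M; y \<in> carrier M; x \<otimes> a = y \<otimes> a\<rbrakk> \<Longrightarrow> x = y"
begin

text \<open>Cancelling \<open>x\<close> in \<open>x (y x) = (x y) x = x\<close> shows that one-sided
  inverses are two-sided. Later proofs therefore only have to exhibit a one-sided inverse to obtain
  a unit.\<close>

lemma mult_eq_one_commute: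
  assumes "x \<in> carrier M" "y \<in> carrier M" "x \<otimes> y = \<one>"
  shows "y \<otimes> x = \<one>"
proof (rule mult_left_cancel[of x])
  show "x \<otimes> (y \<otimes> x) = x \<otimes> \<one>"
    using assms by (simp flip: m_assoc)
qed (use assms in auto)

lemma mult_eq_one_imp_Units:
  assumes "x \<in> carrier M" "y \<in> carrier M" "x \<otimes> y = \<one>"
  shows "x \<in> Units M" "y \<in> Units M"
  using assms mult_eq_one_commute[OF assms] by (auto simp: Units_def)

lemma Units_mult_imp_Units_right:
  assumes "x \<in> carrier M" "y \<in> carrier M" "x \<otimes> y \<in> Units M"
  shows "y \<in> Units M"
proof (rule mult_eq_one_imp_Units(2))
  \<comment> \<open>The witness is a left inverse of \<open>y\<close>, read off from
    \<open>inv (x y) (x y) = 1\<close> by reassociating.\<close>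
  show "(inv (x \<otimes> y) \<otimes> x) \<otimes> y = \<one>"
    using assms by (simp add: m_assoc)
qed (use assms in auto)

text \<open>Along an infinite descent \<open>f k = f (k+1) v\<close> with non-units
  \<open>v\<close>, the right ideals \<open>f k M\<close> ascend. Where they stabilize,
  \<open>f (N+1) = f N w\<close>, and cancellation turns \<open>f (N+1) = f (N+1) v w\<close> into
  \<open>v w = 1\<close>, so \<open>v\<close> would be a unit.\<close>

lemma proper_left_factor_wf:
  assumes "satisfies_ACCP M"
  shows "wf {(u, x). u \<in> carrier M \<and> (\<exists>v\<in>carrier M. v \<notin> Units M \<and> x = u \<otimes> v)}"
    (is "wf ?r")
proof (rule ccontr)
  assume "\<not> wf ?r"
  then obtain f where f: "\<And>i. (f (Suc i), f i) \<in> ?r"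
    unfolding wf_iff_no_infinite_down_chain by blast
  have carr: "f k \<in> carrier M" for k
    using f[of k] by auto
  have "f k <# carrier M \<subseteq> f (Suc k) <# carrier M" for k
    using f[of k] by (fastforce simp: l_coset_def m_assoc)
  with assms carr obtain N where N: "\<forall>k\<ge>N. f k <# carrier M = f N <# carrier M"
    unfolding satisfies_ACCP_def by blast
  \<comment> \<open>One equality of consecutive ideals already contradicts the properness of the
    step from \<open>f N\<close> to \<open>f (Suc N)\<close>.\<close>
  have "f (Suc N) <# carrier M = f N <# carrier M"
    by (rule N[rule_format]) simp
  moreover have "f (Suc N) \<in> f (Suc N) <# carrier M"
    using carr[of "Suc N"] by (auto simp: l_coset_def intro!: bexI[of _ \<one>])
  ultimately obtain w where w: "w \<in> carrier M" "f (Suc N) = f N \<otimes> w"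
    by (auto simp: l_coset_def)
  obtain v where v: "v \<in> carrier M" "v \<notin> Units M" "f N = f (Suc N) \<otimes> v"
    using f[of N] by auto
  have "f (Suc N) \<otimes> (v \<otimes> w) = f (Suc N) \<otimes> \<one>"
    using v w carr[of "Suc N"] by (metis m_assoc r_one)
  then have "v \<otimes> w = \<one>"
    using v w carr mult_left_cancel by blast
  with v w show False
    using mult_eq_one_imp_Units by blast
qed

text \<open>Mirror image of the previous argument, with left ideals and cancellation on the
  right.\<close>

lemma proper_right_factor_wf:
  assumes "satisfies_ACCP M"
  shows "wf {(v, x). v \<in> carrier M \<and> (\<exists>u\<in>carrier M. u \<notin> Units M \<and> x = u \<otimes> v)}"
    (is "wf ?r")
proof (rule ccontr)
  assume "\<not> wf ?r"
  then obtain f where f: "\<And>i. (f (Suc i), f i) \<in> ?r"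
    unfolding wf_iff_no_infinite_down_chain by blast
  have carr: "f k \<in> carrier M" for k
    using f[of k] by auto
  have "carrier M #> f k \<subseteq> carrier M #> f (Suc k)" for k
    using f[of k] by (fastforce simp: r_coset_def simp flip: m_assoc)
  with assms carr obtain N where N: "\<forall>k\<ge>N. carrier M #> f k = carrier M #> f N"
    unfolding satisfies_ACCP_def by blast
  have "carrier M #> f (Suc N) = carrier M #> f N"
    by (rule N[rule_format]) simp
  moreover have "f (Suc N) \<in> carrier M #> f (Suc N)"
    using carr[of "Suc N"] by (auto simp: r_coset_def intro!: bexI[of _ \<one>])
  ultimately obtain w where w: "w \<in> carrier M" "f (Suc N) = w \<otimes> f N"
    by (auto simp: r_coset_def)
  obtain u where u: "u \<in> carrier M" "u \<notin> Units M" "f N = u \<otimes> f (Suc N)"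
    using f[of N] by auto
  have "(w \<otimes> u) \<otimes> f (Suc N) = \<one> \<otimes> f (Suc N)"
    using u w carr[of "Suc N"] by (metis m_assoc l_one)
  then have "w \<otimes> u = \<one>"
    using u w carr mult_right_cancel by blast
  with u w show False
    using mult_eq_one_imp_Units by blast
qed

lemma ACCP_imp_atom_left_factor:
  assumes "satisfies_ACCP M" "x \<in> carrier M" "x \<notin> Units M"
  shows "\<exists>a y. monoid_atom M a \<and> y \<in> carrier M \<and> x = a \<otimes> y"
  using assms(2,3)
proof (induction x rule: wf_induct_rule[OF proper_left_factor_wf[OF assms(1)]])
  case (1 x)
  show ?case
  proof (cases "monoid_atom M x")
    case True
    with 1 show ?thesis
      by (metis one_closed r_one)
  next
    case False
    with 1 obtain u v where uv: "u \<in> carrier M" "v \<in> carrier M" "x = u \<otimes> v"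
        "u \<notin> Units M" "v \<notin> Units M"
      by (auto simp: monoid_atom_def)
    \<comment> \<open>Since \<open>v\<close> is a non-unit, \<open>u\<close> is a proper left factor
      of \<open>x\<close>; an atom on the left of \<open>u\<close> is also one on the left of
      \<open>x\<close>, and \<open>v\<close> moves into the cofactor.\<close>
    with 1(1)[of u] obtain a y where ay: "monoid_atom M a" "y \<in> carrier M" "u = a \<otimes> y"
      by blast
    then have "x = a \<otimes> (y \<otimes> v)" "y \<otimes> v \<in> carrier M"
      using uv by (auto simp: monoid_atom_def m_assoc)
    with ay show ?thesis
      by blast
  qed
qed

theorem ACCP_imp_atomic:
  assumes "satisfies_ACCP M"
  shows "atomic_monoid M"
proof -
  have "\<exists>as. (\<forall>a\<in>set as. monoid_atom M a) \<and> x = foldr (\<otimes>) as \<one>"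
    if "x \<in> carrier M" "x \<notin> Units M" for x
    using that
  proof (induction x rule: wf_induct_rule[OF proper_right_factor_wf[OF assms]])
    case (1 x)
    show ?case
    proof (cases "monoid_atom M x")
      case True
      with 1 show ?thesis
        by (intro exI[of _ "[x]"]) simp
    next
      case False
      with 1 obtain u v where uv: "u \<in> carrier M" "v \<in> carrier M" "x = u \<otimes> v"
          "u \<notin> Units M" "v \<notin> Units M"
        by (auto simp: monoid_atom_def)
      then obtain a y where ay: "monoid_atom M a" "y \<in> carrier M" "u = a \<otimes> y"
        using ACCP_imp_atom_left_factor[OF assms] by blast
      then have a: "a \<in> carrier M" "a \<notin> Units M"
        by (auto simp: monoid_atom_def)
      have x: "x = a \<otimes> (y \<otimes> v)"
        using uv ay a by (simp add: m_assoc)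
      \<comment> \<open>The cofactor stays a non-unit because its right factor \<open>v\<close> is
        one. As the atom \<open>a\<close> is a non-unit too, the cofactor is a proper right factor
        of \<open>x\<close>, to which the induction hypothesis applies.\<close>
      have yv: "y \<otimes> v \<in> carrier M" "y \<otimes> v \<notin> Units M"
        using uv(2,5) ay(2) Units_mult_imp_Units_right[of y v] by blast+
      with 1(1)[of "y \<otimes> v"] a x obtain as
        where "\<forall>b\<in>set as. monoid_atom M b" "y \<otimes> v = foldr (\<otimes>) as \<one>"
        by blast
      with ay x show ?thesis
        by (intro exI[of _ "a # as"]) simp
    qed
  qed
  then show ?thesis
    by (simp add: atomic_monoid_def)
qed

end

section \<open>Cancellation for unitriangular matrices\<close>

lemma unitriangular_carrierD:
  assumes "A \<in> carrier (unitriangular n)"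
  shows "A \<in> carrier_mat n n" "\<And>i j. j < i \<Longrightarrow> i < n \<Longrightarrow> A $$ (i, j) = 0"
    "\<And>i. i < n \<Longrightarrow> A $$ (i, i) = 1"
  using assms by (auto simp: unitriangular_def)

lemma index_mult_mat_sum:
  assumes "A \<in> carrier_mat n m" "B \<in> carrier_mat m p" "i < n" "j < p"
  shows "(A * B) $$ (i, j) = (\<Sum>k<m. A $$ (i, k) * B $$ (k, j))"
  using assms by (simp add: scalar_prod_def atLeast0LessThan)

lemma unitriangular_mult_closed:
  fixes A B :: "'a :: semiring_1 mat"
  assumes A: "A \<in> carrier (unitriangular n)" and B: "B \<in> carrier (unitriangular n)"
  shows "A * B \<in> carrier (unitriangular n)"
proof -
  note [simp] = unitriangular_carrierD[OF A] unitriangular_carrierD[OF B]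
  have carr: "A * B \<in> carrier_mat n n"
    by (rule mult_carrier_mat[of _ n n]) simp_all
  have low: "(A * B) $$ (i, j) = 0" if "j < i" "i < n" for i j
  proof -
    \<comment> \<open>For \<open>k < i\<close> the entry of \<open>A\<close> lies below the
      diagonal; otherwise \<open>j < i \<le> k\<close>, and the entry of \<open>B\<close>
      does.\<close>
    have "A $$ (i, k) * B $$ (k, j) = 0" if "k < n" for k
      using \<open>j < i\<close> \<open>i < n\<close> that by (cases "k < i") simp_all
    with that show ?thesis
      by (simp add: index_mult_mat_sum[of _ n n _ n])
  qed
  have diag: "(A * B) $$ (i, i) = 1" if "i < n" for i
  proof -
    have "A $$ (i, k) * B $$ (k, i) = (if k = i then 1 else 0)" if "k < n" for k
      using \<open>i < n\<close> that by (cases k i rule: linorder_cases) simp_all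
    with that show ?thesis
      by (simp add: index_mult_mat_sum[of _ n n _ n])
  qed
  show ?thesis
    using carr low diag by (auto simp: unitriangular_def)
qed

text \<open>Row \<open>i\<close> of \<open>A * B\<close> is row \<open>i\<close> of \<open>B\<close>
  plus a combination of later rows of \<open>B\<close>. Hence the rows of \<open>B\<close> are
  determined by the product from the last one upwards.\<close>

lemma unitriangular_mult_left_cancel:
  fixes A B C :: "'a :: {semiring_1, cancel_semigroup_add} mat"
  assumes A: "A \<in> carrier (unitriangular n)"
    and B: "B \<in> carrier_mat n m" and C: "C \<in> carrier_mat n m"
    and eq: "A * B = A * C"
  shows "B = C"
proof -
  note [simp] = unitriangular_carrierD[OF A]
  have entries: "B $$ (i, j) = C $$ (i, j)" if "j < m" "i < n" for i j
    using \<open>i < n\<close>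
  \<comment> \<open>The measure \<open>n - i\<close> makes the induction hypothesis cover the rows
    below row \<open>i\<close>.\<close>
  proof (induction "n - i" arbitrary: i rule: less_induct)
    case less
    have split: "(A * D) $$ (i, j) = D $$ (i, j) + (\<Sum>k\<in>{..<n} - {i}. A $$ (i, k) * D $$ (k, j))"
      if "D \<in> carrier_mat n m" for D
      using that less.prems \<open>j < m\<close>
      by (simp add: index_mult_mat_sum[of _ n n _ m] sum.remove[of _ i])
    \<comment> \<open>Terms with \<open>k < i\<close> vanish by triangularity, and those with
      \<open>k > i\<close> agree by induction. Additive cancellation of this common sum then leaves
      the entries of \<open>B\<close> and \<open>C\<close>.\<close>
    have "(\<Sum>k\<in>{..<n} - {i}. A $$ (i, k) * B $$ (k, j)) = (\<Sum>k\<in>{..<n} - {i}. A $$ (i, k) * C $$ (k, j))"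
    proof (rule sum.cong)
      fix k assume "k \<in> {..<n} - {i}"
      then show "A $$ (i, k) * B $$ (k, j) = A $$ (i, k) * C $$ (k, j)"
        using less.prems less.hyps[of k] by (cases "k < i") (simp_all add: diff_less_mono2)
    qed simp
    then show ?case
      using split[OF B] split[OF C] eq by simp
  qed
  show ?thesis
    by (rule eq_matI) (use B C entries in auto)
qed

text \<open>Column \<open>j\<close> of \<open>B * A\<close> is column \<open>j\<close> of
  \<open>B\<close> plus a combination of earlier columns, so here the recovery runs from the first
  column rightwards.\<close>

lemma unitriangular_mult_right_cancel:
  fixes A B C :: "'a :: {semiring_1, cancel_semigroup_add} mat"
  assumes A: "A \<in> carrier (unitriangular n)"
    and B: "B \<in> carrier_mat m n" and C: "C \<in> carrier_mat m n"
    and eq: "B * A = C * A"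
  shows "B = C"
proof -
  note [simp] = unitriangular_carrierD[OF A]
  have entries: "B $$ (i, j) = C $$ (i, j)" if "i < m" "j < n" for i j
    using \<open>j < n\<close>
  proof (induction j rule: less_induct)
    case (less j)
    have split: "(D * A) $$ (i, j) = D $$ (i, j) + (\<Sum>k\<in>{..<n} - {j}. D $$ (i, k) * A $$ (k, j))"
      if "D \<in> carrier_mat m n" for D
      using that less.prems \<open>i < m\<close>
      by (simp add: index_mult_mat_sum[of _ m n _ n] sum.remove[of _ j])
    have "(\<Sum>k\<in>{..<n} - {j}. B $$ (i, k) * A $$ (k, j)) = (\<Sum>k\<in>{..<n} - {j}. C $$ (i, k) * A $$ (k, j))"
    proof (rule sum.cong)
      fix k assume "k \<in> {..<n} - {j}"
      then show "B $$ (i, k) * A $$ (k, j) = C $$ (i, k) * A $$ (k, j)"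
        using less by (cases "k < j") simp_all
    qed simp
    then show ?case
      using split[OF B] split[OF C] eq by simp
  qed
  show ?thesis
    by (rule eq_matI) (use B C entries in auto)
qed

lemma cancellative_monoid_unitriangular:
  "cancellative_monoid
    (unitriangular n :: 'a :: {semiring_1, cancel_semigroup_add} mat monoid)"
proof
  let ?U = "unitriangular n :: 'a mat monoid"
  have [simp]: "A \<otimes>\<^bsub>?U\<^esub> B = A * B" "\<one>\<^bsub>?U\<^esub> = 1\<^sub>m n" for A B
    by (simp_all add: unitriangular_def)
  note carr = unitriangular_carrierD(1)
  show "A \<otimes>\<^bsub>?U\<^esub> B \<in> carrier ?U" if "A \<in> carrier ?U" "B \<in> carrier ?U" for A B
    using that by (simp add: unitriangular_mult_closed)
  show "\<one>\<^bsub>?U\<^esub> \<in> carrier ?U"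
    by (simp add: unitriangular_def)
  show "A \<otimes>\<^bsub>?U\<^esub> B \<otimes>\<^bsub>?U\<^esub> C = A \<otimes>\<^bsub>?U\<^esub> (B \<otimes>\<^bsub>?U\<^esub> C)"
    if "A \<in> carrier ?U" "B \<in> carrier ?U" "C \<in> carrier ?U" for A B C
    using assoc_mult_mat[OF that[THEN carr]] by simp
  show "\<one>\<^bsub>?U\<^esub> \<otimes>\<^bsub>?U\<^esub> A = A" "A \<otimes>\<^bsub>?U\<^esub> \<one>\<^bsub>?U\<^esub> = A" if "A \<in> carrier ?U" for A
    using carr[OF that] by simp_all
  show "B = C"
    if "A \<in> carrier ?U" "B \<in> carrier ?U" "C \<in> carrier ?U"
      "A \<otimes>\<^bsub>?U\<^esub> B = A \<otimes>\<^bsub>?U\<^esub> C" for A B C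
    using unitriangular_mult_left_cancel[OF that(1) that(2,3)[THEN carr]] that(4) by simp
  show "B = C"
    if "A \<in> carrier ?U" "B \<in> carrier ?U" "C \<in> carrier ?U"
      "B \<otimes>\<^bsub>?U\<^esub> A = C \<otimes>\<^bsub>?U\<^esub> A" for A B C
    using unitriangular_mult_right_cancel[OF that(1) that(2,3)[THEN carr]] that(4) by simp
qed

theorem corollary4p6:
  fixes n :: nat
  assumes "n \<ge> 2"
    and "satisfies_ACCP (unitriangular n :: 'a :: reduced_information_semialgebra mat monoid)"
  shows "atomic_monoid (unitriangular n :: 'a mat monoid)"
  using cancellative_monoid.ACCP_imp_atomic[OF cancellative_monoid_unitriangular assms(2)] .

end
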